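(* Let $(Z,\preceq)$ be a preordered set and let $\Psi$ be a family of functions $\psi\colon Z\to\mathbb{R}\cup\{\pm\infty\}$ which are monotone with respect to $\preceq$. The mapping $D\mapsto \operatorname{cl}_\Psi D$ on the power set $\mathcal{P}(Z)$ is a hull operator, i.e., for all $D,E\in\mathcal{P}(Z)$: (i) $D\subseteq \operatorname{cl}_\Psi D$; (ii) $D\subseteq E$ implies $\operatorname{cl}_\Psi D\subseteq \operatorname{cl}_\Psi E$; (iii) $\operatorname{cl}_\Psi D=\operatorname{cl}_\Psi(\operatorname{cl}_\Psi D)$.
   Context: A preorder is a reflexive and transitive relation. A function $\psi\colon Z\to\mathbb{R}\cup\{\pm\infty\}$ is monotone if $z_1\preceq z_2$ implies $\psi(z_1)\le\psi(z_2)$. $\mathcal{P}(Z)$ is the set of all subsets of $Z$, including $\emptyset$. For $D\in\mathcal{P}(Z)$, $\psi^\triangle(D)=\inf_{z\in D}\psi(z)$ (with $\inf_{z\in\emptyset}\psi(z)=+\infty$) and $\operatorname{cl}_\Psi D=\bigcap_{\psi\in\Psi}\{z\in Z\mid \psi^\triangle(D)\le\psi(z)\}$. *)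

theory Defs
  imports "HOL-Library.Extended_Real"
begin

(* psi^triangle *)
definition inf_ext :: "('z \<Rightarrow> ereal) \<Rightarrow> 'z set \<Rightarrow> ereal"
  where "inf_ext \<psi> D = (INF z\<in>D. \<psi> z)"

lemma inf_ext_empty: "inf_ext \<psi> {} = \<infinity>"
  by (simp add: inf_ext_def top_ereal_def)

(* The intersection is taken inside the power set of Z, so the empty family yields Z.
   Only the values of the functions on Z matter when D is a subset of Z. *)
definition cl :: "'z set \<Rightarrow> ('z \<Rightarrow> ereal) set \<Rightarrow> 'z set \<Rightarrow> 'z set"
  where "cl Z \<Psi> D = Z \<inter> (\<Inter>\<psi>\<in>\<Psi>. {z \<in> Z. inf_ext \<psi> D \<le> \<psi> z})"

definition hull_operator_on :: "'z set \<Rightarrow> ('z set \<Rightarrow> 'z set) \<Rightarrow> bool"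
  where "hull_operator_on Z c \<longleftrightarrow>
    (\<forall>D\<in>Pow Z. c D \<in> Pow Z) \<and>
    (\<forall>D\<in>Pow Z. D \<subseteq> c D) \<and>
    (\<forall>D\<in>Pow Z. \<forall>E\<in>Pow Z. D \<subseteq> E \<longrightarrow> c D \<subseteq> c E) \<and>
    (\<forall>D\<in>Pow Z. c D = c (c D))"

end

theory Submission
  imports Defs
begin

text \<open>The closure of \<open>D\<close> consists of the points of \<open>Z\<close> that respect every lower bound that some
  \<open>\<psi> \<in> \<Psi>\<close> has on \<open>D\<close>. Enlarging \<open>D\<close> lowers these infima and so relaxes the constraints, which gives
  extensivity and monotonicity. Passing from \<open>D\<close> to its closure leaves the infimum of each
  \<open>\<psi> \<in> \<Psi>\<close> unchanged, since the added points take values above it (\<open>inf_ext_cl\<close>); the closure depends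
  on \<open>D\<close> only through these infima, hence it is idempotent.\<close>

lemma mem_cl_iff: "z \<in> cl Z \<Psi> D \<longleftrightarrow> z \<in> Z \<and> (\<forall>\<psi>\<in>\<Psi>. inf_ext \<psi> D \<le> \<psi> z)"
  by (auto simp: cl_def)

lemma inf_ext_antimono: "D \<subseteq> E \<Longrightarrow> inf_ext \<psi> E \<le> inf_ext \<psi> D"
  unfolding inf_ext_def by (rule INF_superset_mono) simp_all

lemma cl_extensive:
  assumes "D \<subseteq> Z"
  shows "D \<subseteq> cl Z \<Psi> D"
  using assms by (auto simp: mem_cl_iff inf_ext_def intro: INF_lower)

lemma cl_mono: "D \<subseteq> E \<Longrightarrow> cl Z \<Psi> D \<subseteq> cl Z \<Psi> E"
  by (meson inf_ext_antimono mem_cl_iff order_trans subsetI)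

lemma inf_ext_cl:
  assumes "D \<subseteq> Z" and "\<psi> \<in> \<Psi>"
  shows "inf_ext \<psi> (cl Z \<Psi> D) = inf_ext \<psi> D"
proof (rule antisym)
  show "inf_ext \<psi> (cl Z \<Psi> D) \<le> inf_ext \<psi> D"
    by (rule inf_ext_antimono[OF cl_extensive[OF assms(1)]])
  have "inf_ext \<psi> D \<le> \<psi> z" if "z \<in> cl Z \<Psi> D" for z
    using that assms(2) by (simp add: mem_cl_iff)
  then show "inf_ext \<psi> D \<le> inf_ext \<psi> (cl Z \<Psi> D)"
    unfolding inf_ext_def[of \<psi> "cl Z \<Psi> D"] by (rule INF_greatest)
qed

lemma cl_idem:
  assumes "D \<subseteq> Z"
  shows "cl Z \<Psi> (cl Z \<Psi> D) = cl Z \<Psi> D"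
  by (rule set_eqI) (simp add: mem_cl_iff[of _ Z \<Psi> "cl Z \<Psi> D"] mem_cl_iff[of _ Z \<Psi> D] inf_ext_cl[OF assms])

theorem proposition2p2:
  fixes Z :: "'z set"
    and r :: "'z rel"
    and \<Psi> :: "('z \<Rightarrow> ereal) set"
  assumes "preorder_on Z r"
    and "\<And>\<psi>. \<psi> \<in> \<Psi> \<Longrightarrow> monotone_on Z (\<lambda>x y. (x, y) \<in> r) (\<le>) \<psi>"
  shows "hull_operator_on Z (cl Z \<Psi>)"
  unfolding hull_operator_on_def
proof (intro conjI ballI impI)
  fix D assume "D \<in> Pow Z"
  then have D: "D \<subseteq> Z" by simp
  show "cl Z \<Psi> D \<in> Pow Z" by (auto simp: mem_cl_iff)
  show "D \<subseteq> cl Z \<Psi> D" by (rule cl_extensive[OF D])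
  show "cl Z \<Psi> D = cl Z \<Psi> (cl Z \<Psi> D)" by (rule cl_idem[OF D, symmetric])
next
  fix D E :: "'z set"
  assume "D \<subseteq> E"
  then show "cl Z \<Psi> D \<subseteq> cl Z \<Psi> E" by (rule cl_mono)
qed

end
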